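(* Let $n\ge1$ and let $\theta$ be an integer. For the given $\theta$, any integer $n$ can be uniquely written as $$n=\frac{k(k+1)}{2}|1-\theta|+l(k+1)+p,\qquad 0\le l<|1-\theta|,\quad 0\le p\le k+1.$$ With these $k,l,p$, define $P(\theta)$ as follows. For $\theta\le1$, let $$P(\theta)=0,\ldots,0,\,l,\,l+(1-\theta),\,l+2(1-\theta),\ldots,l+(k-p)(1-\theta),\,l+(k-p+1)(1-\theta)+1,\ldots,l+k(1-\theta)+1.$$ For $\theta\ge2$, let $$P(\theta)=l+k(\theta-1),\,l+(k-1)(\theta-1),\ldots,l+p(\theta-1),\,l+(p-1)(\theta-1)+1,\ldots,l+(\theta-1)+1,\,l+1$$ (followed by zeros). Then $P(\theta)$ is the fixed point of $L(n,\theta)$.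
   Context: A composition of $n$ is a sequence $a=(a_1,\ldots,a_n)$ of nonnegative integers with $\sum a_i=n$ (not necessarily decreasing, zeros allowed). For an integer $\theta$, a transition $T(\theta)$ transforms a composition $a$ into the composition $(a_1,\ldots,a_i-1,a_{i+1}+1,\ldots,a_n)$ for some $1\le i\le n-1$ with $a_i-a_{i+1}\ge\theta$ (and $a_i\ge1$, so that the result is a composition). $L(n,\theta)$ is the set of all compositions obtained from $N=(n,0,\ldots,0)$ by iterating $T(\theta)$, ordered by: $a\ge_\theta b$ iff $b$ is obtained from $a$ by a (possibly empty) finite sequence of transitions $T(\theta)$. This order is a lattice, so it has only one fixed point, that is, only one element on which no transition $T(\theta)$ can be applied; it is the smallest element of $L(n,\theta)$. In the formula for $P(\theta)$ there are $k+1$ listed entries besides the padding zeros: for $\theta\ge2$, the entry with multiplier $j$ of $(\theta-1)$ is $l+j(\theta-1)$ for $p\le j\le k$ and $l+j(\theta-1)+1$ for $0\le j\le p-1$, in order of decreasing $j$; for $\theta\le1$, the entry with multiplier $j$ of $(1-\theta)$ is $l+j(1-\theta)$ for $0\le j\le k-p$ and $l+j(1-\theta)+1$ for $k-p+1\le j\le k$, in order of increasing $j$. The sequence is understood as a composition of length $n$, with leading zeros when $\theta\le1$ and trailing zeros when $\theta\ge2$ added (or dropped) as needed.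
   Formalization: Uniqueness of k,l,p is stated for 0≤p≤k, since it fails for p≤k+1 (n=1, θ=2: (0,0,1) and (1,0,0)); existence is stated for θ≠1, as 0≤l<|1-θ| is impossible for θ=1. The fixed-point claim covers every representation with p≤k+1. *)

theory Defs
  imports Main
begin

text \<open>Compositions are lists, so the entry \<open>a\<^sub>i\<close> with \<open>1 \<le> i \<le> n\<close> is \<open>a ! (i - 1)\<close>.\<close>

definition compositions :: "nat \<Rightarrow> nat list set" where
  "compositions n = {a. length a = n \<and> sum_list a = n}"

definition transition :: "int \<Rightarrow> nat list \<Rightarrow> nat list \<Rightarrow> bool" where
  "transition \<theta> a b \<longleftrightarrow>
     (\<exists>i. Suc i < length a \<and> a ! i \<ge> 1 \<and> int (a ! i) - int (a ! Suc i) \<ge> \<theta> \<and>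
          b = a[i := a ! i - 1, Suc i := a ! Suc i + 1])"

definition geq_theta :: "int \<Rightarrow> nat list \<Rightarrow> nat list \<Rightarrow> bool" where
  "geq_theta \<theta> a b \<longleftrightarrow> (transition \<theta>)\<^sup>*\<^sup>* a b"

definition initial :: "nat \<Rightarrow> nat list" where
  "initial n = n # replicate (n - 1) 0"

definition L :: "nat \<Rightarrow> int \<Rightarrow> nat list set" where
  "L n \<theta> = {a \<in> compositions n. geq_theta \<theta> (initial n) a}"

definition fixed_point :: "nat \<Rightarrow> int \<Rightarrow> nat list \<Rightarrow> bool" where
  "fixed_point n \<theta> a \<longleftrightarrow> a \<in> L n \<theta> \<and> (\<nexists>b. transition \<theta> a b)"

text \<open>
  Both \<open>p = 0\<close> and \<open>p = k + 1\<close> are admitted here, so \<open>n\<close> may have two decompositions; the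
  decomposition is unique once \<open>p \<le> k\<close> is imposed. There is none for \<open>\<theta> = 1\<close>.
\<close>
definition decomposition :: "nat \<Rightarrow> int \<Rightarrow> nat \<Rightarrow> nat \<Rightarrow> nat \<Rightarrow> bool" where
  "decomposition n \<theta> k l p \<longleftrightarrow>
     int n = int (k * (k + 1) div 2) * \<bar>1 - \<theta>\<bar> + int (l * (k + 1) + p) \<and>
     int l < \<bar>1 - \<theta>\<bar> \<and> p \<le> k + 1"

text \<open>
  In both cases the entry with multiplier \<open>j\<close> is raised by one for exactly \<open>p\<close> values of \<open>j\<close>.
  The condition \<open>j \<le> k - p\<close> is written \<open>j + p \<le> k\<close> because \<open>k - p\<close> is \<open>-1\<close> for \<open>p = k + 1\<close>,
  when no entry is left unraised.
\<close>
definition entries_increasing :: "int \<Rightarrow> nat \<Rightarrow> nat \<Rightarrow> nat \<Rightarrow> nat list" where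
  "entries_increasing \<theta> k l p =
     map (\<lambda>j. l + j * nat (1 - \<theta>) + (if j + p \<le> k then 0 else 1)) [0..<k + 1]"

definition entries_decreasing :: "int \<Rightarrow> nat \<Rightarrow> nat \<Rightarrow> nat \<Rightarrow> nat list" where
  "entries_decreasing \<theta> k l p =
     map (\<lambda>j. l + j * nat (\<theta> - 1) + (if p \<le> j then 0 else 1)) (rev [0..<k + 1])"

text \<open>
  Zeros are added on the left or on the right to reach length \<open>n\<close>; if there are more than \<open>n\<close>
  entries, the surplus ones are dropped on the same side.
\<close>
definition pad_left :: "nat \<Rightarrow> nat list \<Rightarrow> nat list" where
  "pad_left n xs = drop (length xs) (replicate n 0 @ xs)"

definition pad_right :: "nat \<Rightarrow> nat list \<Rightarrow> nat list" where
  "pad_right n xs = take n (xs @ replicate n 0)"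

definition P :: "nat \<Rightarrow> int \<Rightarrow> nat \<Rightarrow> nat \<Rightarrow> nat \<Rightarrow> nat list" where
  "P n \<theta> k l p =
     (if \<theta> \<le> 1 then pad_left n (entries_increasing \<theta> k l p)
      else pad_right n (entries_decreasing \<theta> k l p))"

end

theory Submission
  imports Defs
begin

text \<open>
  Tilt a composition by adding \<open>(\<theta> - 1) * i\<close> to its entry of index \<open>i\<close>. A transition then moves a
  unit to the right exactly when the tilted sequence strictly descends there. Hence, in a stuck
  composition, the tilted sequence does not descend after a positive entry; and in a composition
  reachable from \<open>(n, 0, \<dots>, 0)\<close>, it never rises by more than one above an earlier value at a
  positive entry. Any two sequences with both properties are comparable entrywise, so those with a
  given sum coincide. As \<open>P\<close> has both properties and the rewriting terminates, \<open>P\<close> is the only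
  fixed point.
\<close>

definition tilt :: "int \<Rightarrow> nat list \<Rightarrow> nat \<Rightarrow> int" where
  "tilt \<theta> a i = int (a ! i) + (\<theta> - 1) * int i"

definition rises_at_most_one :: "int \<Rightarrow> nat list \<Rightarrow> bool" where
  "rises_at_most_one \<theta> a \<longleftrightarrow>
     (\<forall>i j. i < j \<longrightarrow> j < length a \<longrightarrow> 0 < a ! j \<longrightarrow> tilt \<theta> a j \<le> tilt \<theta> a i + 1)"

definition stuck :: "int \<Rightarrow> nat list \<Rightarrow> bool" where
  "stuck \<theta> a \<longleftrightarrow> (\<nexists>b. transition \<theta> a b)"

lemma tilt_Suc: "tilt \<theta> a (Suc i) = int (a ! Suc i) + (\<theta> - 1) * int i + (\<theta> - 1)"
  by (simp add: tilt_def algebra_simps)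

lemma stuck_iff:
  "stuck \<theta> a \<longleftrightarrow> (\<forall>i. Suc i < length a \<longrightarrow> 0 < a ! i \<longrightarrow> tilt \<theta> a i \<le> tilt \<theta> a (Suc i))"
proof -
  have "tilt \<theta> a i \<le> tilt \<theta> a (Suc i) \<longleftrightarrow> \<not> \<theta> \<le> int (a ! i) - int (a ! Suc i)" for i
    unfolding tilt_Suc by (auto simp: tilt_def)
  then show ?thesis
    unfolding stuck_def transition_def by (auto simp: Suc_le_eq)
qed

lemma stuck_tilt_le:
  assumes "stuck \<theta> a" "i < j" "j < length a" "0 < a ! i"
  shows "tilt \<theta> a i \<le> tilt \<theta> a j"
proof -
  have "Suc i \<le> j" using assms(2) by simp
  then show ?thesis using assms(3)
  proof (induction j rule: dec_induct)
    case base
    then show ?case using assms(1,4) by (simp add: stuck_iff)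
  next
    case (step j)
    then have le: "tilt \<theta> a i \<le> tilt \<theta> a j" by simp
    show ?case
    proof (cases "0 < a ! j")
      case True
      then have "tilt \<theta> a j \<le> tilt \<theta> a (Suc j)"
        using assms(1) step.prems by (simp add: stuck_iff)
      with le show ?thesis by simp
    next
      case False
      then have *: "int (a ! i) + (\<theta> - 1) * int i \<le> (\<theta> - 1) * int j"
        using le by (simp add: tilt_def)
      then have "0 < (\<theta> - 1) * (int j - int i)"
        using assms(4) by (simp add: algebra_simps)
      then have "0 < \<theta> - 1"
        using step.hyps by (simp add: zero_less_mult_iff)
      with * show ?thesis by (simp add: tilt_Suc) (simp add: tilt_def)
    qed
  qed
qed

lemma transition_rises_at_most_one:
  assumes "transition \<theta> a b" "rises_at_most_one \<theta> a"
  shows "rises_at_most_one \<theta> b"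
proof -
  obtain t where t: "Suc t < length a" "1 \<le> a ! t" "\<theta> \<le> int (a ! t) - int (a ! Suc t)"
    and b: "b = a[t := a ! t - 1, Suc t := a ! Suc t + 1]"
    using assms(1) unfolding transition_def by blast
  have desc: "tilt \<theta> a (Suc t) + 1 \<le> tilt \<theta> a t"
    using t(3) unfolding tilt_Suc by (simp add: tilt_def)
  have tb: "tilt \<theta> b i = tilt \<theta> a i + (if i = t then -1 else if i = Suc t then 1 else 0)"
    if "i < length a" for i
    using that t by (auto simp: b tilt_def nth_list_update of_nat_diff)
  have pos: "0 < a ! j" if "0 < b ! j" "j < length a" "j \<noteq> Suc t" for j
    using that t by (auto simp: b nth_list_update split: if_splits)
  have rise: "tilt \<theta> a j \<le> tilt \<theta> a i + 1" if "i < j" "j < length a" "0 < a ! j" for i j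
    using assms(2) that unfolding rises_at_most_one_def by blast
  show ?thesis
    unfolding rises_at_most_one_def
  proof (intro allI impI)
    fix i j assume ij: "i < j" "j < length b" "0 < b ! j"
    then have len: "i < length a" "j < length a" by (auto simp: b)
    show "tilt \<theta> b j \<le> tilt \<theta> b i + 1"
    proof (cases "j = Suc t")
      case True
      have "tilt \<theta> a t \<le> tilt \<theta> a i + 1" if "i \<noteq> t"
        using rise[of i t] that True ij(1) t by simp
      then show ?thesis
        using True ij(1) len desc by (auto simp: tb)
    next
      case False
      then have p: "0 < a ! j" using pos ij(3) len(2) by blast
      have "tilt \<theta> a j \<le> tilt \<theta> a (Suc t) + 1" if "i = t"
        using rise[of "Suc t" j] p that False ij(1) len by simp
      then show ?thesis
        using rise[OF ij(1) len(2) p] False ij(1) len desc by (auto simp: tb)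
    qed
  qed
qed

lemma transition_split:
  assumes "transition \<theta> a b"
  obtains xs x y ys where "a = xs @ Suc x # y # ys" "b = xs @ x # Suc y # ys"
proof -
  obtain t where t: "Suc t < length a" "1 \<le> a ! t"
    and b: "b = a[t := a ! t - 1, Suc t := a ! Suc t + 1]"
    using assms unfolding transition_def by blast
  define xs ys where "xs = take t a" and "ys = drop (Suc (Suc t)) a"
  have a: "a = xs @ a ! t # a ! Suc t # ys"
    using t(1) by (simp add: xs_def ys_def Cons_nth_drop_Suc)
  have len: "length xs = t" using t(1) by (simp add: xs_def)
  obtain x where x: "a ! t = Suc x" using t(2) by (cases "a ! t") auto
  have "b = (xs @ a ! t # a ! Suc t # ys)[t := a ! t - 1, Suc t := a ! Suc t + 1]"
    using b a by simp
  then have "b = xs @ x # Suc (a ! Suc t) # ys"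
    by (simp add: list_update_append len x)
  with a x show ?thesis by (intro that[of xs x "a ! Suc t" ys]) simp_all
qed

lemma transition_compositions:
  "transition \<theta> a b \<Longrightarrow> a \<in> compositions n \<Longrightarrow> b \<in> compositions n"
  by (erule transition_split) (simp add: compositions_def)

lemma wf_transition: "wf {(b, a). transition \<theta> a b}"
proof (rule wf_subset)
  show "wf (lenlex less_than)" by (simp add: wf_lenlex)
  show "{(b, a). transition \<theta> a b} \<subseteq> lenlex less_than"
  proof clarify
    fix b a assume "transition \<theta> a b"
    then show "(b, a) \<in> lenlex less_than"
      by (rule transition_split) (auto simp: lenlex_conv lex_conv)
  qed
qed

lemma geq_theta_stuck_exists: "\<exists>b. geq_theta \<theta> a b \<and> stuck \<theta> b"
proof (induction a rule: wf_induct_rule[OF wf_transition[of \<theta>]])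
  case (1 a)
  show ?case
  proof (cases "stuck \<theta> a")
    case True
    then show ?thesis unfolding geq_theta_def by blast
  next
    case False
    then obtain b where "transition \<theta> a b" unfolding stuck_def by blast
    with 1[of b] show ?thesis
      unfolding geq_theta_def by (auto intro: converse_rtranclp_into_rtranclp)
  qed
qed

lemma geq_theta_initial:
  assumes "geq_theta \<theta> (initial n) a" "1 \<le> n"
  shows "a \<in> compositions n \<and> rises_at_most_one \<theta> a"
  using assms(1) unfolding geq_theta_def
proof (induction rule: rtranclp_induct)
  case base
  show ?case
    using assms(2)
    by (auto simp: compositions_def initial_def rises_at_most_one_def sum_list_replicate nth_Cons')
next
  case (step a b)
  then show ?case
    using transition_compositions transition_rises_at_most_one by blast
qed

lemma stuck_no_crossing:
  assumes "rises_at_most_one \<theta> a" "stuck \<theta> b" "length a = length b"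
    and "i < j" "j < length a" "a ! i < b ! i"
  shows "a ! j \<le> b ! j"
proof (rule ccontr)
  assume "\<not> a ! j \<le> b ! j"
  moreover have "tilt \<theta> b i \<le> tilt \<theta> b j"
    using stuck_tilt_le[OF assms(2,4)] assms(3,5,6) by simp
  moreover have "tilt \<theta> a j \<le> tilt \<theta> a i + 1" if "0 < a ! j"
    using assms(1,4,5) that unfolding rises_at_most_one_def by blast
  ultimately show False
    using assms(6) unfolding tilt_def by auto
qed

lemma sum_list_nth_le_imp_eq:
  fixes a b :: "nat list"
  assumes "length a = length b" "sum_list a = sum_list b" "\<And>i. i < length a \<Longrightarrow> a ! i \<le> b ! i"
  shows "a = b"
proof (rule nth_equalityI[OF assms(1)])
  fix i assume "i < length a"
  moreover have "sum ((!) a) {0..<length a} = sum ((!) b) {0..<length a}"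
    using assms(1,2) by (simp add: sum_list_sum_nth)
  ultimately show "a ! i = b ! i"
    using sum_mono_inv[of "(!) a" "{0..<length a}" "(!) b" i] assms(3) by simp
qed

lemma stuck_unique:
  assumes a: "a \<in> compositions n" "rises_at_most_one \<theta> a" "stuck \<theta> a"
    and b: "b \<in> compositions n" "rises_at_most_one \<theta> b" "stuck \<theta> b"
  shows "a = b"
proof -
  have len: "length a = length b" and sum: "sum_list a = sum_list b"
    using a(1) b(1) by (auto simp: compositions_def)
  have "(\<forall>i<length a. a ! i \<le> b ! i) \<or> (\<forall>i<length a. b ! i \<le> a ! i)"
  proof (rule ccontr)
    assume "\<not> ?thesis"
    then obtain i j where ij: "i < length a" "b ! i < a ! i" "j < length a" "a ! j < b ! j"
      by (auto simp: not_le)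
    consider "i < j" | "j < i" | "i = j" by linarith
    then show False
    proof cases
      case 1
      then show False using stuck_no_crossing[OF b(2) a(3) len[symmetric] 1] ij len by simp
    next
      case 2
      then show False using stuck_no_crossing[OF a(2) b(3) len 2] ij len by simp
    next
      case 3
      then show False using ij by simp
    qed
  qed
  then show ?thesis
    using sum_list_nth_le_imp_eq[of a b] sum_list_nth_le_imp_eq[of b a] len sum by auto
qed

lemma sum_list_arith_progression:
  "sum_list (map (\<lambda>j. l + j * m + f j) [0..<k + 1]) =
     k * (k + 1) div 2 * m + l * (k + 1) + sum f {..k}"
proof (induction k)
  case (Suc k)
  have "Suc k * (Suc k + 1) div 2 = k * (k + 1) div 2 + Suc k"
    by simp
  with Suc show ?case by (simp add: algebra_simps)
qed simp

lemma decomposition_nat: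
  "decomposition n \<theta> k l p \<longleftrightarrow>
     n = k * (k + 1) div 2 * nat \<bar>1 - \<theta>\<bar> + l * (k + 1) + p \<and> l < nat \<bar>1 - \<theta>\<bar> \<and> p \<le> k + 1"
proof -
  define m where "m = nat \<bar>1 - \<theta>\<bar>"
  have m: "\<bar>1 - \<theta>\<bar> = int m" by (simp add: m_def)
  have "int n = int (k * (k + 1) div 2) * int m + int (l * (k + 1) + p) \<longleftrightarrow>
      n = k * (k + 1) div 2 * m + l * (k + 1) + p"
    by (simp only: of_nat_add[symmetric] of_nat_mult[symmetric] of_nat_eq_iff add.assoc)
  then show ?thesis
    unfolding decomposition_def m by simp
qed

lemma decomposition_surplus:
  assumes "decomposition n \<theta> k l p" "1 \<le> n" "n < k + 1"
  shows "n = 1 \<and> k = 1 \<and> l = 0 \<and> p = 0 \<and> \<bar>1 - \<theta>\<bar> = 1"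
proof -
  define m where "m = nat \<bar>1 - \<theta>\<bar>"
  have n: "n = k * (k + 1) div 2 * m + l * (k + 1) + p" and m: "1 \<le> m"
    using assms(1) by (auto simp: decomposition_nat m_def)
  have k: "1 \<le> k" "n \<le> k" using assms by simp_all
  have "k \<le> k * (k + 1) div 2" using k(1) by (cases k) auto
  moreover have "k * (k + 1) div 2 * 1 \<le> k * (k + 1) div 2 * m" using m by (intro mult_le_mono2)
  ultimately have eqs: "k * (k + 1) div 2 = k" "k * (k + 1) div 2 * m = k" "l * (k + 1) = 0" "p = 0" "n = k"
    using n k(2) by linarith+
  moreover from eqs(1) have "k = 1"
  proof -
    have "even (k * (k + 1))" by simp
    then have "k * (k + 1) = k * 2" using eqs(1) by (metis dvd_div_mult_self)
    then show ?thesis using k(1) by simp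
  qed
  ultimately show ?thesis by (auto simp: m_def)
qed

lemma length_P [simp]: "length (P n \<theta> k l p) = n"
  by (auto simp: P_def pad_left_def pad_right_def min_def)

lemma sum_list_P:
  assumes "decomposition n \<theta> k l p" "1 \<le> n"
  shows "sum_list (P n \<theta> k l p) = n"
proof (cases "k + 1 \<le> n")
  case True
  have p: "p \<le> k + 1" using assms(1) by (simp add: decomposition_def)
  have "(\<Sum>j\<le>k. if j + p \<le> k then 0 else 1) = card {j \<in> {..k}. \<not> j + p \<le> k}"
    by (simp add: sum.If_cases flip: card_eq_sum) (rule arg_cong[of _ _ card], auto)
  also have "{j \<in> {..k}. \<not> j + p \<le> k} = {k + 1 - p..<k + 1}" using p by auto
  finally have inc: "(\<Sum>j\<le>k. if j + p \<le> k then 0 else 1) = p" using p by simp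
  have "(\<Sum>j\<le>k. if p \<le> j then 0 else 1) = card {j \<in> {..k}. \<not> p \<le> j}"
    by (simp add: sum.If_cases flip: card_eq_sum) (rule arg_cong[of _ _ card], auto)
  also have "{j \<in> {..k}. \<not> p \<le> j} = {..<p}" using p by auto
  finally have dec: "(\<Sum>j\<le>k. if p \<le> j then 0 else 1) = p" by simp
  have n: "n = k * (k + 1) div 2 * nat \<bar>1 - \<theta>\<bar> + l * (k + 1) + p"
    using assms(1) by (simp add: decomposition_nat)
  show ?thesis
  proof (cases "\<theta> \<le> 1")
    case le: True
    have "sum_list (P n \<theta> k l p) = sum_list (entries_increasing \<theta> k l p)"
      using True le by (simp add: P_def pad_left_def entries_increasing_def sum_list_replicate)
    also have "\<dots> = n"
      using le n unfolding entries_increasing_def sum_list_arith_progression inc by simp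
    finally show ?thesis .
  next
    case gt: False
    have "sum_list (P n \<theta> k l p) = sum_list (entries_decreasing \<theta> k l p)"
      using True gt by (simp add: P_def pad_right_def entries_decreasing_def sum_list_replicate del: upt_Suc)
    also have "\<dots> = sum_list (map (\<lambda>j. l + j * nat (\<theta> - 1) + (if p \<le> j then 0 else 1)) [0..<k + 1])"
      unfolding entries_decreasing_def by (simp only: sum_list_rev flip: rev_map)
    also have "\<dots> = n"
      using gt n unfolding sum_list_arith_progression dec by simp
    finally show ?thesis .
  qed
next
  case False
  then have "n = 1" "k = 1" "l = 0" "p = 0" "\<bar>1 - \<theta>\<bar> = 1"
    using decomposition_surplus[OF assms] by auto
  then show ?thesis
    by (auto simp: P_def pad_left_def pad_right_def entries_increasing_def entries_decreasing_def
        upt_rec)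
qed

lemma P_nth_increasing:
  assumes "\<theta> \<le> 1" "k + 1 \<le> n" "i < n"
  shows "P n \<theta> k l p ! i =
    (if i + k + 1 < n then 0
     else l + (i + k + 1 - n) * nat (1 - \<theta>) + (if i + p + 1 < n + 1 then 0 else 1))"
  using assms by (auto simp: P_def pad_left_def entries_increasing_def nth_append)

lemma P_nth_decreasing:
  assumes "1 < \<theta>" "k + 1 \<le> n" "i < n"
  shows "P n \<theta> k l p ! i =
    (if k < i then 0 else l + (k - i) * nat (\<theta> - 1) + (if p + i \<le> k then 0 else 1))"
  using assms
  by (auto simp: P_def pad_right_def entries_decreasing_def nth_append rev_nth simp del: upt_Suc)

lemma tilt_P_increasing:
  assumes "\<theta> \<le> 1" "k + 1 \<le> n" "n \<le> i + k + 1" "i < n"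
  shows "tilt \<theta> (P n \<theta> k l p) i =
    int l + (1 - \<theta>) * (int k + 1 - int n) + (if i + p + 1 < n + 1 then 0 else 1)"
proof -
  have "int ((i + k + 1 - n) * nat (1 - \<theta>)) = (int i + int k + 1 - int n) * (1 - \<theta>)"
    using assms(1,3) by (simp add: of_nat_diff)
  then show ?thesis
    using assms by (simp add: tilt_def P_nth_increasing del: of_nat_mult) (simp add: algebra_simps)
qed

lemma tilt_P_decreasing:
  assumes "1 < \<theta>" "k + 1 \<le> n" "i \<le> k"
  shows "tilt \<theta> (P n \<theta> k l p) i =
    int l + (\<theta> - 1) * int k + (if p + i \<le> k then 0 else 1)"
proof -
  have "int ((k - i) * nat (\<theta> - 1)) = (int k - int i) * (\<theta> - 1)"
    using assms(1,3) by (simp add: of_nat_diff)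
  then show ?thesis
    using assms by (simp add: tilt_def P_nth_decreasing del: of_nat_mult) (simp add: algebra_simps)
qed

lemma P_rises_at_most_one_stuck:
  assumes "decomposition n \<theta> k l p" "1 \<le> n"
  shows "rises_at_most_one \<theta> (P n \<theta> k l p) \<and> stuck \<theta> (P n \<theta> k l p)"
proof (cases "k + 1 \<le> n")
  case True
  have l: "int l + 1 \<le> \<bar>1 - \<theta>\<bar>" using assms(1) by (simp add: decomposition_def)
  show ?thesis
  proof (cases "\<theta> \<le> 1")
    case le: True
    show ?thesis
    proof
      show "rises_at_most_one \<theta> (P n \<theta> k l p)"
        unfolding rises_at_most_one_def
      proof (intro allI impI)
        fix i j assume ij: "i < j" "j < length (P n \<theta> k l p)" "0 < P n \<theta> k l p ! j"
        then have j: "j < n" "n \<le> j + k + 1"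
          using le True by (auto simp: P_nth_increasing split: if_splits)
        show "tilt \<theta> (P n \<theta> k l p) j \<le> tilt \<theta> (P n \<theta> k l p) i + 1"
        proof (cases "n \<le> i + k + 1")
          case i: True
          then show ?thesis
            using tilt_P_increasing[OF le True i] tilt_P_increasing[OF le True j(2,1)] ij(1) j(1)
            by simp
        next
          case False
          then have "(1 - \<theta>) * (int i + int k + 2 - int n) \<le> 0"
            using le by (simp add: mult_le_0_iff)
          then have "(1 - \<theta>) * (int k + 1 - int n) + (1 - \<theta>) \<le> (\<theta> - 1) * int i"
            by (simp add: algebra_simps)
          moreover have "tilt \<theta> (P n \<theta> k l p) i = (\<theta> - 1) * int i"
            using False ij(1) j(1) le True by (simp add: tilt_def P_nth_increasing)
          ultimately show ?thesis
            using tilt_P_increasing[OF le True j(2,1)] l le by simp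
        qed
      qed
      show "stuck \<theta> (P n \<theta> k l p)"
        unfolding stuck_iff
      proof (intro allI impI)
        fix i assume i: "Suc i < length (P n \<theta> k l p)" "0 < P n \<theta> k l p ! i"
        then have "n \<le> i + k + 1"
          using le True by (auto simp: P_nth_increasing split: if_splits)
        then show "tilt \<theta> (P n \<theta> k l p) i \<le> tilt \<theta> (P n \<theta> k l p) (Suc i)"
          using i(1) le True by (simp add: tilt_P_increasing)
      qed
    qed
  next
    case gt: False
    then have gt: "1 < \<theta>" by simp
    have small: "i \<le> k" if "i < n" "0 < P n \<theta> k l p ! i" for i
      using that gt True by (auto simp: P_nth_decreasing split: if_splits)
    show ?thesis
    proof
      show "rises_at_most_one \<theta> (P n \<theta> k l p)"
        unfolding rises_at_most_one_def
        using small by (fastforce simp: tilt_P_decreasing[OF gt True])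
      show "stuck \<theta> (P n \<theta> k l p)"
        unfolding stuck_iff
      proof (intro allI impI)
        fix i assume i: "Suc i < length (P n \<theta> k l p)" "0 < P n \<theta> k l p ! i"
        then have ik: "i \<le> k" using small by simp
        show "tilt \<theta> (P n \<theta> k l p) i \<le> tilt \<theta> (P n \<theta> k l p) (Suc i)"
        proof (cases "i = k")
          case eq: True
          have "tilt \<theta> (P n \<theta> k l p) i \<le> (\<theta> - 1) * int k + (\<theta> - 1)"
            using tilt_P_decreasing[OF gt True ik] l gt by simp
          also have "\<dots> \<le> tilt \<theta> (P n \<theta> k l p) (Suc i)"
            unfolding tilt_Suc eq by simp
          finally show ?thesis .
        next
          case False
          then show ?thesis
            using ik gt True by (simp add: tilt_P_decreasing)
        qed
      qed
    qed
  qed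
next
  case False
  then have "n = 1" using decomposition_surplus[OF assms] by auto
  then show ?thesis by (simp add: rises_at_most_one_def stuck_iff)
qed

lemma decomposition_bounds:
  assumes "decomposition n \<theta> k l p" "p \<le> k"
  shows "k * (k + 1) div 2 * nat \<bar>1 - \<theta>\<bar> \<le> n"
    and "n < (k + 1) * (k + 2) div 2 * nat \<bar>1 - \<theta>\<bar>"
proof -
  define m where "m = nat \<bar>1 - \<theta>\<bar>"
  have n: "n = k * (k + 1) div 2 * m + l * (k + 1) + p" and l: "Suc l \<le> m"
    using assms(1) by (auto simp: decomposition_nat m_def)
  show "k * (k + 1) div 2 * nat \<bar>1 - \<theta>\<bar> \<le> n" using n by (simp add: m_def)
  have "Suc l * (k + 1) \<le> m * (k + 1)" using l by (intro mult_le_mono1)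
  moreover have "(k + 1) * (k + 2) div 2 = k * (k + 1) div 2 + (k + 1)" by simp
  ultimately show "n < (k + 1) * (k + 2) div 2 * nat \<bar>1 - \<theta>\<bar>"
    using n assms(2) unfolding m_def[symmetric] by (simp add: algebra_simps)
qed

lemma decomposition_unique:
  assumes "decomposition n \<theta> k l p" "p \<le> k" "decomposition n \<theta> k' l' p'" "p' \<le> k'"
  shows "k = k' \<and> l = l' \<and> p = p'"
proof -
  have not_less: "\<not> j < j'"
    if "decomposition n \<theta> j x y" "y \<le> j" "decomposition n \<theta> j' x' y'" "y' \<le> j'" for j j' x y x' y'
  proof
    assume "j < j'"
    then have "(j + 1) * (j + 2) div 2 \<le> j' * (j' + 1) div 2"
      by (intro div_le_mono mult_le_mono) auto
    then have "(j + 1) * (j + 2) div 2 * nat \<bar>1 - \<theta>\<bar> \<le> j' * (j' + 1) div 2 * nat \<bar>1 - \<theta>\<bar>"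
      by (rule mult_le_mono1)
    then show False
      using decomposition_bounds[OF that(1,2)] decomposition_bounds[OF that(3,4)] by linarith
  qed
  have k: "k = k'"
    using not_less[OF assms] not_less[OF assms(3,4,1,2)] by simp
  with assms have eq: "l * (k + 1) + p = l' * (k + 1) + p'"
    by (simp add: decomposition_nat)
  have "(l * (k + 1) + p) div (k + 1) = l" "(l' * (k + 1) + p') div (k + 1) = l'"
    using assms(2,4) k by (simp_all add: div_mult_self3 del: mult_Suc_right)
  with eq k show ?thesis by simp
qed

lemma decomposition_exists:
  assumes "\<theta> \<noteq> 1"
  shows "\<exists>k l p. decomposition n \<theta> k l p \<and> p \<le> k"
proof -
  define m where "m = nat \<bar>1 - \<theta>\<bar>"
  define Q where "Q k \<longleftrightarrow> n < (k + 1) * (k + 2) div 2 * m" for k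
  have m: "1 \<le> m" using assms by (simp add: m_def)
  have "n + 1 \<le> (n + 1) * (n + 2) div 2" by (cases n) auto
  then have "n + 1 \<le> (n + 1) * (n + 2) div 2 * m" using m by (metis mult.right_neutral mult_le_mono)
  then have "Q n" by (simp add: Q_def)
  define k where "k = (LEAST k. Q k)"
  have up: "n < (k + 1) * (k + 2) div 2 * m"
    using LeastI[of Q, OF \<open>Q n\<close>] by (simp add: Q_def k_def)
  have low: "k * (k + 1) div 2 * m \<le> n"
  proof (cases k)
    case (Suc j)
    then have "\<not> Q j" using not_less_Least[of j Q] by (simp add: k_def)
    then show ?thesis using Suc by (simp add: Q_def)
  qed simp
  define r where "r = n - k * (k + 1) div 2 * m"
  have "(k + 1) * (k + 2) div 2 = k * (k + 1) div 2 + (k + 1)" by simp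
  with up low have "r < (k + 1) * m"
    by (simp add: r_def algebra_simps)
  then have "r div (k + 1) < m" by (simp add: less_mult_imp_div_less mult.commute)
  moreover have "n = k * (k + 1) div 2 * m + r div (k + 1) * (k + 1) + r mod (k + 1)"
    using low by (simp only: r_def add.assoc div_mult_mod_eq)
  moreover have "r mod (k + 1) \<le> k" by (metis Suc_eq_plus1 mod_Suc_le_divisor)
  ultimately have "decomposition n \<theta> k (r div (k + 1)) (r mod (k + 1)) \<and> r mod (k + 1) \<le> k"
    by (simp only: decomposition_nat m_def) simp
  then show ?thesis by blast
qed

theorem proposition4:
  fixes n :: nat and \<theta> :: int
  assumes "n \<ge> 1"
  shows "(\<theta> \<noteq> 1 \<longrightarrow> (\<exists>!t. case t of (k, l, p) \<Rightarrow> decomposition n \<theta> k l p \<and> p \<le> k)) \<and>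
    (\<forall>k l p. decomposition n \<theta> k l p \<longrightarrow>
       fixed_point n \<theta> (P n \<theta> k l p) \<and> (\<forall>a. fixed_point n \<theta> a \<longrightarrow> a = P n \<theta> k l p))"
proof (intro conjI impI allI)
  assume "\<theta> \<noteq> 1"
  then obtain k l p where "decomposition n \<theta> k l p" "p \<le> k"
    using decomposition_exists by blast
  then show "\<exists>!t. case t of (k, l, p) \<Rightarrow> decomposition n \<theta> k l p \<and> p \<le> k"
    using decomposition_unique by (intro ex1I[of _ "(k, l, p)"]) (simp, blast)
next
  fix k l p assume dec: "decomposition n \<theta> k l p"
  have eq: "a = P n \<theta> k l p" if "geq_theta \<theta> (initial n) a" "stuck \<theta> a" for a
  proof (rule stuck_unique[of _ n])
    show "P n \<theta> k l p \<in> compositions n"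
      using sum_list_P[OF dec assms] by (simp add: compositions_def)
  qed (use geq_theta_initial[OF that(1) assms] that(2) P_rises_at_most_one_stuck[OF dec assms]
       in auto)
  obtain a where "geq_theta \<theta> (initial n) a" "stuck \<theta> a"
    using geq_theta_stuck_exists by blast
  then show "fixed_point n \<theta> (P n \<theta> k l p)"
    using eq[of a] geq_theta_initial[OF _ assms, of \<theta> a]
    unfolding fixed_point_def L_def stuck_def by auto
  show "a = P n \<theta> k l p" if "fixed_point n \<theta> a" for a
    using eq[of a] that unfolding fixed_point_def L_def stuck_def by auto
qed

end
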